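(* Let $d\ge 1$. On $C^2([0,1]^2;\mathbb{R}^d)$ consider the equivalence relation $X\sim Y \iff \partial_{12}X=\partial_{12}Y$. For $X\in C^2([0,1]^2;\mathbb{R}^d)$ consider the lift $\hat X\in C^2([0,1]^2;\mathbb{R}^{2+d})$, $$\hat X_{s_1,s_2}:=(s_1^2s_2,\ s_1s_2^2,\ X_{s_1,s_2}).$$ Then for all $X,Y\in C^2([0,1]^2;\mathbb{R}^d)$: $X\sim Y$ if and only if $\mathbf{S}_{\mathbf 0,\mathbf 1}(\hat X)=\mathbf{S}_{\mathbf 0,\mathbf 1}(\hat Y)$, i.e. if and only if $\langle\mathbf{S}_{\mathbf 0,\mathbf 1}(\hat X),(w,\nu)\rangle=\langle\mathbf{S}_{\mathbf 0,\mathbf 1}(\hat Y),(w,\nu)\rangle$ for all extended words $(w,\nu)$ over the alphabet $\{1,\dots,d+2\}$.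
   Context: $\partial_{12}X=\frac{\partial^2X}{\partial r_1\partial r_2}$; $\mathbf 0=(0,0)$, $\mathbf 1=(1,1)$. An extended word of length $n$ is a pair $(w,\nu)$ with $w=(w_1,\dots,w_n)$ a word of length $n$ in the alphabet $\{1,\dots,e\}$ ($e$ the dimension of the target space) and $\nu$ a permutation of $\{1,\dots,n\}$. Full 2D signature of a $C^2$ field $Z:[0,1]^2\to\mathbb R^e$: for $\mathbf s=(s_1,s_2)$, $\mathbf t=(t_1,t_2)$ in $[0,1]^2$ with $s_1\le t_1$, $s_2\le t_2$, $$\langle \mathbf S_{\mathbf s\mathbf t}(Z),(w,\nu)\rangle=\int_{\Delta^n_{[\mathbf s,\mathbf t]}}\prod_{i=1}^n\partial_{12}Z^{w_i}(r_1^i,r_2^{\nu(i)})\,d\mathbf r^1\cdots d\mathbf r^n,$$ where $\mathbf r^i=(r_1^i,r_2^i)$ and $\Delta^n_{[\mathbf s,\mathbf t]}=\{(\mathbf r^1,\dots,\mathbf r^n): s_1\le r_1^1\le\dots\le r_1^n\le t_1,\ s_2\le r_2^1\le\dots\le r_2^n\le t_2\}$ (the value is $1$ for the empty word). *)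

theory Defs
  imports "HOL-Analysis.Analysis"
begin

definition unit_square :: "(real \<times> real) set" where
  "unit_square = {0..1} \<times> {0..1}"

text \<open>Partial derivatives of a field on the closed unit square, taken within \<open>[0,1]\<close>; hence
  one-sided on the boundary, and independent of the values of the field outside the square.\<close>

definition pd1 :: "(real \<times> real \<Rightarrow> 'a::real_normed_vector) \<Rightarrow> real \<times> real \<Rightarrow> 'a" where
  "pd1 X = (\<lambda>(s1, s2). vector_derivative (\<lambda>r. X (r, s2)) (at s1 within {0..1}))"

definition pd2 :: "(real \<times> real \<Rightarrow> 'a::real_normed_vector) \<Rightarrow> real \<times> real \<Rightarrow> 'a" where
  "pd2 X = (\<lambda>(s1, s2). vector_derivative (\<lambda>r. X (s1, r)) (at s2 within {0..1}))"

definition pd12 :: "(real \<times> real \<Rightarrow> 'a::real_normed_vector) \<Rightarrow> real \<times> real \<Rightarrow> 'a" where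
  "pd12 X = pd1 (pd2 X)"

definition C1_square :: "(real \<times> real \<Rightarrow> 'a::real_normed_vector) \<Rightarrow> bool" where
  "C1_square X \<longleftrightarrow>
     continuous_on unit_square X \<and>
     (\<forall>(s1, s2) \<in> unit_square.
        (\<lambda>r. X (r, s2)) differentiable (at s1 within {0..1}) \<and>
        (\<lambda>r. X (s1, r)) differentiable (at s2 within {0..1})) \<and>
     continuous_on unit_square (pd1 X) \<and>
     continuous_on unit_square (pd2 X)"

definition C2_square :: "(real \<times> real \<Rightarrow> 'a::real_normed_vector) \<Rightarrow> bool" where
  "C2_square X \<longleftrightarrow> C1_square X \<and> C1_square (pd1 X) \<and> C1_square (pd2 X)"

definition pd12_equiv ::
    "(real \<times> real \<Rightarrow> 'a::real_normed_vector) \<Rightarrow> (real \<times> real \<Rightarrow> 'a) \<Rightarrow> bool" where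
  "pd12_equiv X Y \<longleftrightarrow> (\<forall>p \<in> unit_square. pd12 X p = pd12 Y p)"

text \<open>For a field with values in \<open>real ^ 'e\<close> the alphabet is the index type \<open>'e\<close>. Positions in a
  word are numbered from \<open>0\<close>, so \<open>\<nu>\<close> permutes \<open>{0,\<dots>,n-1}\<close>.\<close>

type_synonym 'e xword = "'e list \<times> (nat \<Rightarrow> nat)"

definition extended_words :: "'e xword set" where
  "extended_words = {(w, \<nu>). \<nu> permutes {..<length w}}"

definition simplex2 :: "nat \<Rightarrow> real \<times> real \<Rightarrow> real \<times> real \<Rightarrow> (nat \<Rightarrow> real \<times> real) set" where
  "simplex2 n s t = {r \<in> {..<n} \<rightarrow>\<^sub>E UNIV.
     (\<forall>i<n. fst s \<le> fst (r i) \<and> fst (r i) \<le> fst t \<and> snd s \<le> snd (r i) \<and> snd (r i) \<le> snd t) \<and>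
     (\<forall>i j. i \<le> j \<longrightarrow> j < n \<longrightarrow> fst (r i) \<le> fst (r j) \<and> snd (r i) \<le> snd (r j))}"

definition signature2D ::
    "(real \<times> real \<Rightarrow> real ^ 'e) \<Rightarrow> real \<times> real \<Rightarrow> real \<times> real \<Rightarrow> 'e xword \<Rightarrow> real" where
  "signature2D Z s t = (\<lambda>(w, \<nu>).
     LINT r : simplex2 (length w) s t | PiM {..<length w} (\<lambda>_. lborel :: (real \<times> real) measure).
       (\<Prod>i<length w. pd12 Z (fst (r i), snd (r (\<nu> i))) $ (w ! i)))"

text \<open>The index type \<open>2 + 'd\<close> is the disjoint sum of the two-element numeral type (with elements
  \<open>0\<close> and \<open>1\<close>, indexing the two additional coordinates) and \<open>'d\<close>.\<close>

definition lift2D :: "(real \<times> real \<Rightarrow> real ^ 'd) \<Rightarrow> real \<times> real \<Rightarrow> real ^ (2 + 'd)" where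
  "lift2D X = (\<lambda>(s1, s2). \<chi> k. case k of
       Inl j \<Rightarrow> (if j = 0 then s1\<^sup>2 * s2 else s1 * s2\<^sup>2)
     | Inr i \<Rightarrow> X (s1, s2) $ i)"

end

theory Submission
  imports Defs
begin

text \<open>The mixed derivative of the lift is \<open>(2x, 2y, \<partial>\<^sub>1\<^sub>2X)\<close>. For a word consisting of \<open>a\<close> copies of the
  first extra letter, \<open>b\<close> copies of the second one and a final letter \<open>i\<close>, paired with the identity
  permutation, all points but the last range over the rectangle spanned by the origin and the last
  point \<open>(x, y)\<close>. By homogeneity the inner integral is a positive multiple of
  \<open>(x\<^sup>2y)\<^sup>a (xy\<^sup>2)\<^sup>b\<close>, so the signature determines all integrals of
  \<open>\<partial>\<^sub>1\<^sub>2X\<^sup>i\<close> against these monomials. The map \<open>(x, y) \<mapsto> (x\<^sup>2y, xy\<^sup>2)\<close> is injective off the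
  axes, which it collapses to a point; hence for a continuous \<open>f\<close> with vanishing moments \<open>x y f\<close>
  factors continuously through it and is by Stone-Weierstrass a uniform limit of polynomials in the
  two monomials. This gives \<open>\<integral> x y f\<^sup>2 = 0\<close>, and thus \<open>f = 0\<close>.\<close>

section \<open>Iterated integrals over ordered points\<close>

interpretation lborel_family: product_sigma_finite "\<lambda>_::nat. lborel :: (real \<times> real) measure"
  by standard

text \<open>For the identity permutation the signature integrand is a product of functions of the
  single points \<open>r i\<close>. This is that case with one arbitrary scalar density per
  position, a form that admits recursion over the last point.\<close>

definition ordered_integral :: "(real \<times> real \<Rightarrow> real) list \<Rightarrow> real \<times> real \<Rightarrow> real" where
  "ordered_integral gs t =
     (LINT r : simplex2 (length gs) (0, 0) t | PiM {..<length gs} (\<lambda>_. lborel :: (real \<times> real) measure).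
       (\<Prod>i<length gs. (gs ! i) (r i)))"

lemma unit_square_eq_cbox: "unit_square = cbox (0, 0) (1, 1)"
  unfolding unit_square_def by (auto simp: cbox_Pair_eq)

lemma simplex2_measurable:
  "simplex2 n s t \<in> sets (PiM {..<n} (\<lambda>_. lborel :: (real \<times> real) measure))" (is "_ \<in> sets ?M")
proof -
  have comp: "(\<lambda>r. fst (r i)) \<in> borel_measurable ?M" "(\<lambda>r. snd (r i)) \<in> borel_measurable ?M" if "i < n" for i
  proof -
    have c: "(\<lambda>r. r i) \<in> measurable ?M borel"
      using measurable_component_singleton[of i "{..<n}" "\<lambda>_. lborel :: (real \<times> real) measure"] that by simp
    show "(\<lambda>r. fst (r i)) \<in> borel_measurable ?M" "(\<lambda>r. snd (r i)) \<in> borel_measurable ?M"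
      by (rule borel_measurable_continuous_onI[THEN measurable_compose[OF c]], intro continuous_intros)+
  qed
  have "simplex2 n s t = {r \<in> space ?M.
     (\<forall>i\<in>{..<n}. fst s \<le> fst (r i) \<and> fst (r i) \<le> fst t \<and> snd s \<le> snd (r i) \<and> snd (r i) \<le> snd t) \<and>
     (\<forall>i\<in>{..<n}. \<forall>j\<in>{i..<n}. fst (r i) \<le> fst (r j) \<and> snd (r i) \<le> snd (r j))}"
    unfolding simplex2_def by (auto simp: space_PiM)
  also have "\<dots> \<in> sets ?M"
    by (intro sets.sets_Collect_conj sets.sets_Collect_finite_All borel_measurable_le comp
        borel_measurable_const) auto
  finally show ?thesis .
qed

lemma simplex2_component:
  assumes "r \<in> simplex2 n (0, 0) t" and "t \<in> unit_square" and "i < n"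
  shows "r i \<in> unit_square"
proof -
  have "0 \<le> fst (r i)" "fst (r i) \<le> fst t" "0 \<le> snd (r i)" "snd (r i) \<le> snd t"
    using assms(1,3) by (auto simp: simplex2_def)
  moreover have "fst t \<le> 1" "snd t \<le> 1"
    using assms(2) by (auto simp: unit_square_def)
  ultimately show ?thesis
    by (cases "r i") (simp add: unit_square_def)
qed

text \<open>The last point dominates all earlier ones in both coordinates, so once it is fixed it
  replaces \<open>t\<close> as their upper corner. Extensionality of \<open>y\<close> matches the
  value \<open>undefined\<close> that \<open>simplex2\<close> prescribes outside the index
  set.\<close>

lemma merge_in_simplex2_Suc:
  assumes y: "y \<in> extensional {..<N}"
  shows "merge {N} {..<N} (x, y) \<in> simplex2 (Suc N) (0, 0) t \<longleftrightarrow>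
    x N \<in> cbox (0, 0) t \<and> y \<in> simplex2 N (0, 0) (x N)" (is "?r \<in> _ \<longleftrightarrow> ?R")
proof -
  have rN: "?r N = x N" by (simp add: merge_def)
  have ri: "?r i = y i" if "i < N" for i using that by (simp add: merge_def)
  have ext: "?r \<in> {..<Suc N} \<rightarrow>\<^sub>E UNIV"
    by (auto simp: PiE_def merge_def extensional_def)
  have ext': "y \<in> {..<N} \<rightarrow>\<^sub>E UNIV" using y by (auto simp: PiE_def)
  have box: "p \<in> cbox (0, 0) t \<longleftrightarrow> 0 \<le> fst p \<and> fst p \<le> fst t \<and> 0 \<le> snd p \<and> snd p \<le> snd t"
    for p :: "real \<times> real"
    by (cases t; cases p) (auto simp: cbox_Pair_eq)
  show ?thesis
  proof
    assume L: "?r \<in> simplex2 (Suc N) (0, 0) t"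
    have bd: "0 \<le> fst (?r i) \<and> fst (?r i) \<le> fst t \<and> 0 \<le> snd (?r i) \<and> snd (?r i) \<le> snd t" if "i < Suc N" for i
      using L that by (simp add: simplex2_def)
    have mn: "fst (?r i) \<le> fst (?r j) \<and> snd (?r i) \<le> snd (?r j)" if "i \<le> j" "j < Suc N" for i j
      using L that by (simp add: simplex2_def)
    have "fst (y i) \<le> fst (x N) \<and> snd (y i) \<le> snd (x N) \<and> 0 \<le> fst (y i) \<and> 0 \<le> snd (y i)" if "i < N" for i
      using mn[of i N] bd[of i] that by (simp add: rN ri)
    moreover have "fst (y i) \<le> fst (y j) \<and> snd (y i) \<le> snd (y j)" if "i \<le> j" "j < N" for i j
      using mn[of i j] that by (simp add: rN ri)
    ultimately show ?R
      using bd[of N] ext' by (auto simp: box simplex2_def rN)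
  next
    assume R: ?R
    hence xN: "0 \<le> fst (x N)" "fst (x N) \<le> fst t" "0 \<le> snd (x N)" "snd (x N) \<le> snd t"
      by (auto simp: box)
    have bd: "0 \<le> fst (y i) \<and> fst (y i) \<le> fst (x N) \<and> 0 \<le> snd (y i) \<and> snd (y i) \<le> snd (x N)" if "i < N" for i
      using R that by (simp add: simplex2_def)
    have mn: "fst (y i) \<le> fst (y j) \<and> snd (y i) \<le> snd (y j)" if "i \<le> j" "j < N" for i j
      using R that by (simp add: simplex2_def)
    have "0 \<le> fst (?r i) \<and> fst (?r i) \<le> fst t \<and> 0 \<le> snd (?r i) \<and> snd (?r i) \<le> snd t" if "i < Suc N" for i
      using that bd[of i] xN by (cases "i = N") (auto simp: rN ri)
    moreover have "fst (?r i) \<le> fst (?r j) \<and> snd (?r i) \<le> snd (?r j)" if "i \<le> j" "j < Suc N" for i j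
      using that bd[of i] mn[of i j] by (cases "i = N"; cases "j = N") (auto simp: rN ri)
    ultimately show "?r \<in> simplex2 (Suc N) (0, 0) t"
      using ext by (simp add: simplex2_def)
  qed
qed

text \<open>Outside the square the densities are arbitrary. Cut off by its indicator each one is
  integrable, hence so is their product over independent points; on the simplex all cutoffs equal
  1.\<close>

lemma ordered_integrand_integrable:
  fixes gs :: "(real \<times> real \<Rightarrow> real) list"
  assumes cont: "\<And>g. g \<in> set gs \<Longrightarrow> continuous_on unit_square g" and t: "t \<in> unit_square"
  shows "set_integrable (PiM {..<length gs} (\<lambda>_. lborel)) (simplex2 (length gs) (0, 0) t)
    (\<lambda>r. \<Prod>i<length gs. (gs ! i) (r i))"
proof -
  let ?M = "PiM {..<length gs} (\<lambda>_. lborel :: (real \<times> real) measure)"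
  let ?S = "simplex2 (length gs) (0, 0) t"
  let ?h = "\<lambda>i p. indicator unit_square p *\<^sub>R (gs ! i) p"
  have "integrable lborel (?h i)" if "i \<in> {..<length gs}" for i
    by (rule borel_integrable_compact) (use that cont in \<open>auto simp: unit_square_eq_cbox\<close>)
  hence "integrable ?M (\<lambda>r. \<Prod>i<length gs. ?h i (r i))"
    by (intro lborel_family.product_integrable_prod) auto
  hence "integrable ?M (\<lambda>r. indicator ?S r *\<^sub>R (\<Prod>i<length gs. ?h i (r i)))"
    by (intro integrable_mult_indicator simplex2_measurable)
  moreover have "indicator ?S r *\<^sub>R (\<Prod>i<length gs. ?h i (r i)) = indicator ?S r *\<^sub>R (\<Prod>i<length gs. (gs ! i) (r i))" for r
  proof (cases "r \<in> ?S")
    case True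
    have "(\<Prod>i<length gs. ?h i (r i)) = (\<Prod>i<length gs. (gs ! i) (r i))"
      using simplex2_component[OF True t] by (intro prod.cong) auto
    thus ?thesis by simp
  qed simp
  ultimately show ?thesis
    unfolding set_integrable_def by (simp only:)
qed

lemma ordered_integral_Nil [simp]: "ordered_integral [] t = 1"
proof -
  have "simplex2 0 (0, 0) t = {\<lambda>_. undefined}"
    by (auto simp: simplex2_def)
  thus ?thesis
    by (simp add: ordered_integral_def set_lebesgue_integral_def PiM_empty lebesgue_integral_count_space_finite)
qed

lemma ordered_integral_cong:
  assumes "length gs = length hs" and "t \<in> unit_square"
    and "\<And>i p. i < length hs \<Longrightarrow> p \<in> unit_square \<Longrightarrow> (gs ! i) p = (hs ! i) p"
  shows "ordered_integral gs t = ordered_integral hs t"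
  unfolding ordered_integral_def assms(1)
proof (rule set_lebesgue_integral_cong[OF simplex2_measurable], intro allI impI prod.cong refl)
  fix r i
  assume "r \<in> simplex2 (length hs) (0, 0) t" and "i \<in> {..<length hs}"
  thus "(gs ! i) (r i) = (hs ! i) (r i)"
    using assms(3) simplex2_component[OF _ assms(2)] by simp
qed

text \<open>Fubini with the last point outermost: when it equals \<open>q\<close>, the others range
  over the simplex with corner \<open>q\<close>. Continuity of \<open>ordered_integral gs\<close>
  makes the outer integrand integrable; in the applications it is read off from an explicit
  formula.\<close>

lemma ordered_integral_snoc:
  assumes gs: "\<And>g. g \<in> set gs \<Longrightarrow> continuous_on unit_square g" and g: "continuous_on unit_square g"
    and I: "continuous_on unit_square (ordered_integral gs)" and t: "t \<in> unit_square"
  shows "ordered_integral (gs @ [g]) t = integral (cbox (0, 0) t) (\<lambda>q. g q * ordered_integral gs q)"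
proof -
  let ?N = "length gs"
  let ?M = "\<lambda>I. PiM I (\<lambda>_::nat. lborel :: (real \<times> real) measure)"
  let ?F = "\<lambda>r. indicator (simplex2 (Suc ?N) (0, 0) t) r *\<^sub>R (\<Prod>i<Suc ?N. ((gs @ [g]) ! i) (r i))"
  let ?G = "\<lambda>q. indicator (cbox (0, 0) t) q *\<^sub>R (g q * ordered_integral gs q)"
  have sub: "cbox (0, 0) t \<subseteq> unit_square"
    using t by (cases t) (auto simp: unit_square_def cbox_Pair_eq)
  have cont: "continuous_on (cbox (0, 0) t) (\<lambda>q. g q * ordered_integral gs q)"
    by (intro continuous_intros continuous_on_subset[OF g sub] continuous_on_subset[OF I sub])
  have intG: "integrable lborel ?G"
    by (intro borel_integrable_compact cont) auto
  have dom: "{?N} \<union> {..<?N} = {..<Suc ?N}" by auto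
  have "set_integrable (?M {..<Suc ?N}) (simplex2 (Suc ?N) (0, 0) t)
      (\<lambda>r. \<Prod>i<Suc ?N. ((gs @ [g]) ! i) (r i))"
    using ordered_integrand_integrable[of "gs @ [g]" t] gs g t by auto
  hence intF: "integrable (?M ({?N} \<union> {..<?N})) ?F"
    by (simp only: dom set_integrable_def)
  \<comment> \<open>The indicator of the large simplex splits into the indicator of the box at the
    last point and that of the smaller simplex at the others.\<close>
  have inner: "(\<integral>y. ?F (merge {?N} {..<?N} (x, y)) \<partial>?M {..<?N}) = ?G (x ?N)" for x
  proof -
    have "(\<integral>y. ?F (merge {?N} {..<?N} (x, y)) \<partial>?M {..<?N}) =
      (\<integral>y. (indicator (cbox (0, 0) t) (x ?N) * g (x ?N)) *
         (indicator (simplex2 ?N (0, 0) (x ?N)) y *\<^sub>R (\<Prod>i<?N. (gs ! i) (y i))) \<partial>?M {..<?N})"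
    proof (intro Bochner_Integration.integral_cong refl)
      fix y assume "y \<in> space (?M {..<?N})"
      hence y: "y \<in> extensional {..<?N}" by (simp add: space_PiM PiE_def)
      have "(\<Prod>i<?N. ((gs @ [g]) ! i) (merge {?N} {..<?N} (x, y) i)) = (\<Prod>i<?N. (gs ! i) (y i))"
        by (intro prod.cong) (auto simp: nth_append merge_def)
      moreover have "merge {?N} {..<?N} (x, y) ?N = x ?N" by (simp add: merge_def)
      ultimately show "?F (merge {?N} {..<?N} (x, y)) = (indicator (cbox (0, 0) t) (x ?N) * g (x ?N)) *
         (indicator (simplex2 ?N (0, 0) (x ?N)) y *\<^sub>R (\<Prod>i<?N. (gs ! i) (y i)))"
        using merge_in_simplex2_Suc[OF y, of x t] by (simp add: indicator_def)
    qed
    also have "\<dots> = ?G (x ?N)"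
      by (simp add: ordered_integral_def set_lebesgue_integral_def)
    finally show ?thesis .
  qed
  have "ordered_integral (gs @ [g]) t = (\<integral>r. ?F r \<partial>?M ({?N} \<union> {..<?N}))"
    unfolding dom by (simp add: ordered_integral_def set_lebesgue_integral_def)
  also have "\<dots> = (\<integral>x. (\<integral>y. ?F (merge {?N} {..<?N} (x, y)) \<partial>?M {..<?N}) \<partial>?M {?N})"
    by (rule lborel_family.product_integral_fold[OF _ _ _ intF]) auto
  also have "\<dots> = (\<integral>x. ?G (x ?N) \<partial>?M {?N})"
    by (simp only: inner)
  also have "\<dots> = (\<integral>q. ?G q \<partial>lborel)"
    by (rule lborel_family.product_integral_singleton) (use intG in auto)
  also have "\<dots> = integral (cbox (0, 0) t) (\<lambda>q. g q * ordered_integral gs q)"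
    using set_borel_integral_eq_integral(2)[of "cbox (0, 0) t" "\<lambda>q. g q * ordered_integral gs q"] intG
    by (simp add: set_integrable_def set_lebesgue_integral_def)
  finally show ?thesis .
qed

section \<open>Explicit evaluation for the densities \<open>2x\<close> and \<open>2y\<close>\<close>

lemma integral_monomial_cbox:
  fixes x y :: real
  assumes "0 \<le> x" "0 \<le> y"
  shows "integral (cbox (0, 0) (x, y)) (\<lambda>q. fst q ^ m * snd q ^ n) =
    x ^ Suc m / Suc m * (y ^ Suc n / Suc n)"
proof -
  have pow: "integral {0..z} (\<lambda>u. u ^ k) = z ^ Suc k / Suc k" if "0 \<le> z" for z :: real and k
  proof -
    have "((\<lambda>u. u ^ k) has_integral z ^ Suc k / Suc k - 0 ^ Suc k / Suc k) {0..z}"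
      by (rule fundamental_theorem_of_calculus[OF that])
        (auto intro!: derivative_eq_intros simp flip: has_real_derivative_iff_has_vector_derivative
          simp del: power_Suc of_nat_Suc)
    thus ?thesis by (simp add: integral_unique)
  qed
  have "integral (cbox (0, 0) (x, y)) (\<lambda>q. fst q ^ m * snd q ^ n) =
      integral (cbox 0 x) (\<lambda>u. integral (cbox 0 y) (\<lambda>v. u ^ m * v ^ n))"
    by (subst integral_prod_continuous) (auto intro!: continuous_intros)
  also have "\<dots> = x ^ Suc m / Suc m * (y ^ Suc n / Suc n)"
    by (simp add: pow assms del: power_Suc of_nat_Suc)
  finally show ?thesis .
qed

text \<open>Integrating a monomial over a rectangle at the origin gives a monomial again. A density
  \<open>2x\<close> raises the exponents by (2, 1) and a density \<open>2y\<close> by (1, 2). Of the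
  constant only its positivity and its independence of \<open>t\<close> matter later.\<close>

lemma ordered_integral_monomial:
  "\<exists>c>0. \<forall>t\<in>unit_square.
     ordered_integral (replicate a (\<lambda>p. 2 * fst p) @ replicate b (\<lambda>p. 2 * snd p)) t =
       c * (fst t ^ (2 * a + b) * snd t ^ (a + 2 * b))"
proof -
  \<comment> \<open>Covers both densities at once: \<open>k = 1\<close>, \<open>l = 0\<close> gives
    \<open>2x\<close>, and \<open>k = 0\<close>, \<open>l = 1\<close> gives
    \<open>2y\<close>.\<close>
  have step: "\<exists>c>0. \<forall>t\<in>unit_square. ordered_integral (gs @ [\<lambda>p. 2 * (fst p ^ k * snd p ^ l)]) t =
        c * (fst t ^ (Suc (m + k)) * snd t ^ (Suc (n + l)))"
    if gs: "\<And>g. g \<in> set gs \<Longrightarrow> continuous_on unit_square g"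
      and ex: "\<exists>c>0. \<forall>t\<in>unit_square. ordered_integral gs t = c * (fst t ^ m * snd t ^ n)"
    for gs k l m n
  proof -
    from ex obtain c where c: "c > 0"
      and eq: "\<And>t. t \<in> unit_square \<Longrightarrow> ordered_integral gs t = c * (fst t ^ m * snd t ^ n)" by blast
    have cont: "continuous_on unit_square (ordered_integral gs)"
      by (subst continuous_on_cong[OF refl eq]) (auto intro!: continuous_intros)
    show ?thesis
    proof (intro exI conjI ballI)
      \<comment> \<open>The 2 comes from the new density, the denominators from the two
        antiderivatives.\<close>
      show "2 * c / (real (Suc (m + k)) * real (Suc (n + l))) > 0"
        using c by (intro divide_pos_pos) (simp_all del: of_nat_Suc of_nat_mult of_nat_add)
      fix t assume t: "t \<in> unit_square"
      obtain x y where xy: "t = (x, y)" "0 \<le> x" "0 \<le> y"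
        using t by (auto simp: unit_square_def)
      have sub: "q \<in> unit_square" if "q \<in> cbox (0, 0) t" for q
        using t that by (cases t) (auto simp: unit_square_def cbox_Pair_eq)
      have "ordered_integral (gs @ [\<lambda>p. 2 * (fst p ^ k * snd p ^ l)]) t =
          integral (cbox (0, 0) t) (\<lambda>q. 2 * (fst q ^ k * snd q ^ l) * ordered_integral gs q)"
        by (rule ordered_integral_snoc[OF gs _ cont t]) (auto intro!: continuous_intros)
      also have "\<dots> = integral (cbox (0, 0) t) (\<lambda>q. 2 * c * (fst q ^ (m + k) * snd q ^ (n + l)))"
        by (intro integral_cong) (simp add: eq[OF sub] power_add)
      also have "\<dots> = 2 * c * (x ^ Suc (m + k) / Suc (m + k) * (y ^ Suc (n + l) / Suc (n + l)))"
        unfolding xy(1) by (simp add: integral_monomial_cbox xy del: power_Suc of_nat_Suc)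
      finally show "ordered_integral (gs @ [\<lambda>p. 2 * (fst p ^ k * snd p ^ l)]) t =
          2 * c / (real (Suc (m + k)) * real (Suc (n + l))) * (fst t ^ (Suc (m + k)) * snd t ^ (Suc (n + l)))"
        by (simp add: xy(1) del: power_Suc of_nat_Suc)
    qed
  qed
  have A: "\<exists>c>0. \<forall>t\<in>unit_square. ordered_integral (replicate a (\<lambda>p. 2 * fst p)) t =
       c * (fst t ^ (2 * a) * snd t ^ a)"
  proof (induction a)
    case 0
    show ?case by (intro exI[of _ 1]) simp
  next
    case (Suc a)
    have "replicate (Suc a) (\<lambda>p :: real \<times> real. 2 * fst p) = replicate a (\<lambda>p. 2 * fst p) @ [\<lambda>p. 2 * fst p]"
      by (simp add: replicate_append_same)
    thus ?case
      using step[OF _ Suc, of 1 0] by (simp add: continuous_intros del: replicate_Suc)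
  qed
  show ?thesis
  proof (induction b)
    case 0
    show ?case using A by simp
  next
    case (Suc b)
    let ?gs = "replicate a (\<lambda>p :: real \<times> real. 2 * fst p) @ replicate b (\<lambda>p. 2 * snd p)"
    have "replicate a (\<lambda>p :: real \<times> real. 2 * fst p) @ replicate (Suc b) (\<lambda>p. 2 * snd p) = ?gs @ [\<lambda>p. 2 * snd p]"
      by (simp add: replicate_append_same)
    moreover have "continuous_on unit_square g" if "g \<in> set ?gs" for g
      using that by (auto intro!: continuous_intros)
    ultimately show ?case
      using step[OF _ Suc, of 0 1] by (simp del: replicate_Suc)
  qed
qed

section \<open>A moment problem on the square\<close>

text \<open>On a compact set \<open>\<phi>\<close> is a closed map, hence a quotient map onto its
  image, and a continuous function that is constant on the fibres descends to the image.\<close>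

lemma continuous_factor_through_compact:
  fixes \<phi> :: "'a::t2_space \<Rightarrow> 'b::t2_space" and h :: "'a \<Rightarrow> 'c::topological_space"
  assumes S: "compact S" and \<phi>: "continuous_on S \<phi>" and h: "continuous_on S h"
    and fib: "\<And>x y. x \<in> S \<Longrightarrow> y \<in> S \<Longrightarrow> \<phi> x = \<phi> y \<Longrightarrow> h x = h y"
  obtains q where "continuous_on (\<phi> ` S) q" and "\<And>x. x \<in> S \<Longrightarrow> q (\<phi> x) = h x"
proof
  let ?q = "\<lambda>z. h (inv_into S \<phi> z)"
  show q: "?q (\<phi> x) = h x" if "x \<in> S" for x
    using that by (intro fib) (auto intro: inv_into_into f_inv_into_f)
  have "closed (?q -` B \<inter> \<phi> ` S)" if "closed B" for B
  proof -
    have "closed (h -` B \<inter> S)"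
      using h S that by (simp add: continuous_on_closed_vimage compact_imp_closed)
    hence "compact (h -` B \<inter> S)"
      using S by (metis compact_Int_closed inf.absorb_iff2 inf.commute inf_le2)
    hence "compact (\<phi> ` (h -` B \<inter> S))"
      by (intro compact_continuous_image continuous_on_subset[OF \<phi>]) auto
    \<comment> \<open>The preimage chosen by \<open>inv_into\<close> is immaterial by
      \<open>fib\<close>, so preimages under \<open>?q\<close> are images of preimages under
      \<open>h\<close>.\<close>
    moreover have "?q -` B \<inter> \<phi> ` S = \<phi> ` (h -` B \<inter> S)"
      using q by auto
    ultimately show ?thesis by (simp add: compact_imp_closed)
  qed
  thus "continuous_on (\<phi> ` S) ?q"
    using S \<phi> by (simp add: continuous_on_closed_vimage compact_imp_closed compact_continuous_image)
qed

lemma box_Pair_eq: "box (a, c) (b, d) = box a b \<times> box c d"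
  by (force simp: box_def Basis_prod_def)

text \<open>The two values multiply to the cube of \<open>x * y\<close>, which determines
  \<open>x * y\<close>. They are also \<open>x\<close> and \<open>y\<close> times
  \<open>x * y\<close>, so dividing recovers the point when this product is nonzero.\<close>

lemma moment_map_fibres:
  fixes x y x' y' :: real
  assumes nn: "0 \<le> x" "0 \<le> y" "0 \<le> x'" "0 \<le> y'"
    and e1: "x\<^sup>2 * y = x'\<^sup>2 * y'" and e2: "x * y\<^sup>2 = x' * y'\<^sup>2"
  shows "x * y = x' * y'" and "x * y \<noteq> 0 \<Longrightarrow> x = x' \<and> y = y'"
proof -
  have "(x * y) ^ 3 = (x\<^sup>2 * y) * (x * y\<^sup>2)" by (simp add: power2_eq_square power3_eq_cube)
  also have "\<dots> = (x' * y') ^ 3" unfolding e1 e2 by (simp add: power2_eq_square power3_eq_cube)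
  finally have cubes: "(x * y) ^ 3 = (x' * y') ^ 3" .
  show eq: "x * y = x' * y'"
    by (rule power_eq_imp_eq_base[OF cubes]) (use nn in simp_all)
  assume ne: "x * y \<noteq> 0"
  have "x * (x * y) = x' * (x * y)" using e1 eq by (simp add: power2_eq_square mult.assoc)
  moreover have "y * (x * y) = y' * (x' * y')"
    using e2 by (simp add: power2_eq_square mult.left_commute)
  hence "y * (x * y) = y' * (x * y)" unfolding eq .
  ultimately show "x = x' \<and> y = y'" using ne by simp
qed

text \<open>Bridges the moments, which test only monomials, and Stone-Weierstrass, which yields a
  polynomial function in the inductive sense.\<close>

lemma polynomial_orthogonal:
  fixes f :: "real \<times> real \<Rightarrow> real" and \<phi> :: "real \<times> real \<Rightarrow> real \<times> real"
  assumes f: "continuous_on (cbox u v) f" and \<phi>: "continuous_on (cbox u v) \<phi>"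
    and zero: "\<And>a b. integral (cbox u v) (\<lambda>p. f p * (fst (\<phi> p) ^ a * snd (\<phi> p) ^ b)) = 0"
    and g: "real_polynomial_function g"
  shows "integral (cbox u v) (\<lambda>p. f p * g (\<phi> p)) = 0"
proof -
  let ?m = "\<lambda>a b p. f p * (fst (\<phi> p) ^ a * snd (\<phi> p) ^ b)"
  \<comment> \<open>Asking for all \<open>a\<close> and \<open>b\<close> makes \<open>V\<close>
    stable under multiplication by a component of \<open>\<phi>\<close>: the extra factor only
    raises an exponent.\<close>
  define V where "V h \<longleftrightarrow> continuous_on (cbox u v) h \<and> (\<forall>a b. integral (cbox u v) (\<lambda>p. ?m a b p * h p) = 0)"
    for h :: "real \<times> real \<Rightarrow> real"
  have int: "(\<lambda>p. ?m a b p * h p) integrable_on cbox u v" if "continuous_on (cbox u v) h" for a b h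
    by (intro integrable_continuous continuous_intros f \<phi> that)
  have V_lin: "V (\<lambda>p. \<alpha> * h p + \<beta> * k p)" if "V h" "V k" for h k \<alpha> \<beta>
  proof -
    have hk: "continuous_on (cbox u v) h" "continuous_on (cbox u v) k" using that by (auto simp: V_def)
    have "integral (cbox u v) (\<lambda>p. ?m a b p * (\<alpha> * h p + \<beta> * k p)) = 0" for a b
    proof -
      have "(\<lambda>p. ?m a b p * (\<alpha> * h p + \<beta> * k p)) = (\<lambda>p. \<alpha> * (?m a b p * h p) + \<beta> * (?m a b p * k p))"
        by (simp add: algebra_simps)
      hence "integral (cbox u v) (\<lambda>p. ?m a b p * (\<alpha> * h p + \<beta> * k p)) =
          \<alpha> * integral (cbox u v) (\<lambda>p. ?m a b p * h p) + \<beta> * integral (cbox u v) (\<lambda>p. ?m a b p * k p)"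
        by (simp only:) (intro integral_unique has_integral_add has_integral_mult_right
            integrable_integral int hk)
      thus ?thesis using that by (simp add: V_def)
    qed
    thus ?thesis using hk by (auto simp: V_def intro!: continuous_intros)
  qed
  have V_fst: "V (\<lambda>p. fst (\<phi> p) * h p)" and V_snd: "V (\<lambda>p. snd (\<phi> p) * h p)" if "V h" for h
  proof -
    have h: "continuous_on (cbox u v) h" and z: "\<And>a b. integral (cbox u v) (\<lambda>p. ?m a b p * h p) = 0"
      using that by (auto simp: V_def)
    show "V (\<lambda>p. fst (\<phi> p) * h p)"
      unfolding V_def using z[of "Suc _" _] h \<phi> by (auto simp: mult_ac intro!: continuous_intros)
    show "V (\<lambda>p. snd (\<phi> p) * h p)"
      unfolding V_def using z[of _ "Suc _"] h \<phi> by (auto simp: mult_ac intro!: continuous_intros)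
  qed
  \<comment> \<open>Polynomials act on \<open>V\<close> by multiplication; in this form products need no expansion into monomials.\<close>
  have "V h \<Longrightarrow> V (\<lambda>p. g (\<phi> p) * h p)" for h
    using g
  proof (induction arbitrary: h)
    case (linear g)
    have lin: "g z = g (1, 0) * fst z + g (0, 1) * snd z" for z
    proof -
      have "z = fst z *\<^sub>R (1, 0) + snd z *\<^sub>R (0, 1)" by (cases z) simp
      hence "g z = g (fst z *\<^sub>R (1, 0) + snd z *\<^sub>R (0, 1))" by (rule arg_cong)
      also have "\<dots> = g (1, 0) * fst z + g (0, 1) * snd z"
        using bounded_linear.linear[OF linear.hyps]
        by (simp only: linear_add linear_cmul real_scaleR_def mult.commute)
      finally show ?thesis .
    qed
    have "(\<lambda>p. g (\<phi> p) * h p) = (\<lambda>p. g (1, 0) * (fst (\<phi> p) * h p) + g (0, 1) * (snd (\<phi> p) * h p))"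
      by (simp only: lin[of "\<phi> _"] distrib_right mult.assoc)
    thus ?case using V_lin[OF V_fst V_snd] linear.prems by simp
  next
    case (const c)
    show ?case using V_lin[OF const const, of c 0] by simp
  next
    case (add g1 g2)
    show ?case using V_lin[OF add.IH(1) add.IH(2), of h h 1 1] add.prems by (simp add: algebra_simps)
  next
    case (mult g1 g2)
    show ?case using mult.IH(1)[OF mult.IH(2)[OF mult.prems]] by (simp add: mult.assoc)
  qed
  moreover have "V (\<lambda>_. 1)"
    using zero by (simp add: V_def)
  ultimately have "V (\<lambda>p. g (\<phi> p) * 1)" by blast
  hence "integral (cbox u v) (\<lambda>p. ?m 0 0 p * (g (\<phi> p) * 1)) = 0" unfolding V_def by blast
  thus ?thesis by simp
qed

lemma vanishing_moments_imp_zero: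
  fixes f :: "real \<times> real \<Rightarrow> real"
  assumes f: "continuous_on unit_square f"
    and zero: "\<And>a b. integral unit_square (\<lambda>p. f p * (fst p ^ (2 * a + b) * snd p ^ (a + 2 * b))) = 0"
    and p: "p \<in> unit_square"
  shows "f p = 0"
proof -
  define \<phi> :: "real \<times> real \<Rightarrow> real \<times> real" where "\<phi> p = ((fst p)\<^sup>2 * snd p, fst p * (snd p)\<^sup>2)" for p
  \<comment> \<open>The weight vanishes on the axes, which \<open>\<phi>\<close> sends to one point;
    \<open>f\<close> itself may vary there.\<close>
  let ?h = "\<lambda>p. fst p * snd p * f p"
  let ?Q = "cbox (0, 0) (1, 1) :: (real \<times> real) set"
  note sq = unit_square_eq_cbox
  have f': "continuous_on ?Q f" using f by (simp add: sq)
  have \<phi>: "continuous_on ?Q \<phi>" unfolding \<phi>_def by (intro continuous_intros)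
  have mom: "integral ?Q (\<lambda>p. f p * (fst (\<phi> p) ^ a * snd (\<phi> p) ^ b)) = 0" for a b
    using zero[of a b] unfolding \<phi>_def sq power_add power_mult power_mult_distrib fst_conv snd_conv
    by (simp add: mult_ac)
  have h: "continuous_on ?Q ?h" by (intro continuous_intros f')
  have fib: "?h p = ?h p'" if "p \<in> ?Q" "p' \<in> ?Q" "\<phi> p = \<phi> p'" for p p'
  proof -
    have nn: "0 \<le> fst p" "0 \<le> snd p" "0 \<le> fst p'" "0 \<le> snd p'"
      using that(1,2) by (auto simp: cbox_Pair_eq)
    note fibres = moment_map_fibres[OF nn]
    have e: "(fst p)\<^sup>2 * snd p = (fst p')\<^sup>2 * snd p'" "fst p * (snd p)\<^sup>2 = fst p' * (snd p')\<^sup>2"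
      using that(3) by (auto simp: \<phi>_def)
    show ?thesis
    proof (cases "fst p * snd p = 0")
      case True
      thus ?thesis using fibres(1)[OF e] by auto
    next
      case False
      hence "p = p'" using fibres(2)[OF e] by (simp add: prod_eq_iff)
      thus ?thesis by simp
    qed
  qed
  obtain q where q: "continuous_on (\<phi> ` ?Q) q" and q\<phi>: "\<And>p. p \<in> ?Q \<Longrightarrow> q (\<phi> p) = ?h p"
    using continuous_factor_through_compact[OF compact_cbox \<phi> h fib] by metis
  obtain B where B: "B > 0" "\<And>p. p \<in> ?Q \<Longrightarrow> \<bar>f p\<bar> \<le> B"
    using compact_imp_bounded[OF compact_continuous_image[OF f' compact_cbox]]
    by (auto simp: bounded_pos)
  have "\<bar>integral ?Q (\<lambda>p. f p * ?h p)\<bar> \<le> e" if e: "e > 0" for e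
  proof -
    \<comment> \<open>Since \<open>B\<close> bounds \<open>f\<close> and the square has area 1, the
      accuracy \<open>e / B\<close> changes the integral of \<open>f p * ?h p\<close> by at most
      \<open>e\<close>.\<close>
    obtain g where g: "real_polynomial_function g" "\<And>z. z \<in> \<phi> ` ?Q \<Longrightarrow> \<bar>q z - g z\<bar> < e / B"
      using Stone_Weierstrass_real_polynomial_function[OF compact_continuous_image[OF \<phi> compact_cbox] q, of "e / B"]
        e B by auto
    have contg: "continuous_on ?Q (\<lambda>p. g (\<phi> p))"
      by (rule continuous_on_compose2[OF continuous_on_polymonial_function \<phi>, of g UNIV])
        (use g(1) in \<open>auto simp: real_polynomial_function_eq\<close>)
    have i1: "(\<lambda>p. f p * ?h p) integrable_on ?Q" and i2: "(\<lambda>p. f p * g (\<phi> p)) integrable_on ?Q"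
      by (intro integrable_continuous continuous_intros f' contg)+
    have "((\<lambda>p. f p * ?h p - f p * g (\<phi> p)) has_integral
        (integral ?Q (\<lambda>p. f p * ?h p) - integral ?Q (\<lambda>p. f p * g (\<phi> p)))) ?Q"
      using i1 i2 by (intro has_integral_diff integrable_integral)
    moreover have "integral ?Q (\<lambda>p. f p * g (\<phi> p)) = 0"
      by (rule polynomial_orthogonal[OF f' \<phi> mom g(1)])
    moreover have "norm (f p * ?h p - f p * g (\<phi> p)) \<le> e" if p: "p \<in> ?Q" for p
    proof -
      have "norm (f p * ?h p - f p * g (\<phi> p)) = \<bar>f p\<bar> * \<bar>q (\<phi> p) - g (\<phi> p)\<bar>"
        by (simp add: q\<phi>[OF p] flip: right_diff_distrib abs_mult)
      also have "\<dots> \<le> B * (e / B)"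
        using B(2)[OF p] g(2)[of "\<phi> p"] p B(1) by (intro mult_mono) auto
      finally show ?thesis using B(1) by simp
    qed
    ultimately show ?thesis
      using has_integral_bound[of e "\<lambda>p. f p * ?h p - f p * g (\<phi> p)" "integral ?Q (\<lambda>p. f p * ?h p)" "(0, 0)" "(1, 1)"] e
      by (simp add: content_Pair)
  qed
  hence "\<bar>integral ?Q (\<lambda>p. f p * ?h p)\<bar> \<le> 0"
    by (rule field_le_epsilon) (simp only: add_0)
  hence "integral ?Q (\<lambda>p. f p * ?h p) = 0" by (simp only: abs_le_zero_iff)
  \<comment> \<open>The integrand is \<open>x y f\<^sup>2\<close>, continuous and nonnegative on the
    square.\<close>
  hence "\<forall>p\<in>?Q. f p * ?h p = 0"
    by (subst (asm) integral_cbox_eq_0_iff)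
      (intro continuous_intros f', auto simp: box_Pair_eq cbox_Pair_eq mult_ac)
  \<comment> \<open>The weight is positive in the open square; continuity then carries the zero
    value to the boundary.\<close>
  hence "\<forall>p\<in>box (0, 0) (1, 1). f p = 0"
    by (force simp: box_Pair_eq cbox_Pair_eq)
  moreover have "closure (box (0, 0) (1, 1)) = ?Q"
    by (rule closure_box) (auto simp: box_Pair_eq)
  ultimately show ?thesis
    using continuous_constant_on_closure[of "box (0, 0) (1, 1)" f 0 p] f' p unfolding sq by simp
qed

section \<open>The lifted field\<close>

lemma has_vector_derivative_cart:
  fixes f :: "real \<Rightarrow> real ^ 'n"
  shows "(f has_vector_derivative f') (at a within S) \<longleftrightarrow>
    (\<forall>k. ((\<lambda>x. f x $ k) has_vector_derivative f' $ k) (at a within S))"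
  unfolding has_vector_derivative_def
  by (subst has_derivative_componentwise_within) (auto simp: Basis_vec_def inner_axis)

text \<open>Common shape of the lift and of its partial derivatives, so that a single
  differentiation rule serves both orders.\<close>

definition vec_lift :: "real \<Rightarrow> real \<Rightarrow> real ^ 'd \<Rightarrow> real ^ (2 + 'd)" where
  "vec_lift u v z = (\<chi> k. case k of Inl j \<Rightarrow> (if j = 0 then u else v) | Inr i \<Rightarrow> z $ i)"

lemma has_vector_derivative_vec_lift:
  fixes z :: "real \<Rightarrow> real ^ 'd"
  assumes "(u has_vector_derivative u') (at a within S)" "(v has_vector_derivative v') (at a within S)"
    and "(z has_vector_derivative z') (at a within S)"
  shows "((\<lambda>r. vec_lift (u r) (v r) (z r)) has_vector_derivative vec_lift u' v' z') (at a within S)"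
proof -
  have z: "((\<lambda>r. z r $ i) has_vector_derivative z' $ i) (at a within S)" for i
    using assms(3) by (simp add: has_vector_derivative_cart)
  show ?thesis
    unfolding has_vector_derivative_cart
  proof
    fix k :: "2 + 'd"
    show "((\<lambda>r. vec_lift (u r) (v r) (z r) $ k) has_vector_derivative vec_lift u' v' z' $ k) (at a within S)"
      using assms(1,2) z by (cases k) (auto simp: vec_lift_def)
  qed
qed

text \<open>Differentiating in \<open>s2\<close> turns the extra coordinates into
  \<open>s1\<^sup>2\<close> and \<open>2 * s1 * s2\<close>; differentiating these in
  \<open>s1\<close> gives \<open>2 * s1\<close> and \<open>2 * s2\<close>.\<close>

lemma pd12_lift2D:
  assumes X: "C2_square X" and p: "(s1, s2) \<in> unit_square"
  shows "pd12 (lift2D X) (s1, s2) = vec_lift (2 * s1) (2 * s2) (pd12 X (s1, s2))"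
proof -
  have pd2: "pd2 (lift2D X) (r, s) = vec_lift (r\<^sup>2) (2 * r * s) (pd2 X (r, s))"
    if "r \<in> {0..1}" "s \<in> {0..1}" for r s
  proof -
    have "(\<lambda>t. X (r, t)) differentiable (at s within {0..1})"
      using X that by (auto simp: C2_square_def C1_square_def unit_square_def)
    hence "((\<lambda>t. X (r, t)) has_vector_derivative pd2 X (r, s)) (at s within {0..1})"
      by (simp add: pd2_def vector_derivative_works)
    hence "((\<lambda>t. vec_lift (r\<^sup>2 * t) (r * t\<^sup>2) (X (r, t))) has_vector_derivative
        vec_lift (r\<^sup>2) (2 * r * s) (pd2 X (r, s))) (at s within {0..1})"
      by (intro has_vector_derivative_vec_lift)
        (auto intro!: derivative_eq_intros simp flip: has_real_derivative_iff_has_vector_derivative)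
    moreover have "(\<lambda>t. vec_lift (r\<^sup>2 * t) (r * t\<^sup>2) (X (r, t))) = (\<lambda>t. lift2D X (r, t))"
      by (simp add: lift2D_def vec_lift_def)
    ultimately show ?thesis
      using that by (simp add: pd2_def vector_derivative_within_closed_interval)
  qed
  have s: "s1 \<in> {0..1}" "s2 \<in> {0..1}" using p by (auto simp: unit_square_def)
  have "(\<lambda>r. pd2 X (r, s2)) differentiable (at s1 within {0..1})"
    using X p by (auto simp: C2_square_def C1_square_def)
  hence "((\<lambda>r. pd2 X (r, s2)) has_vector_derivative pd12 X (s1, s2)) (at s1 within {0..1})"
    by (simp add: pd12_def pd1_def vector_derivative_works)
  hence "((\<lambda>r. vec_lift (r\<^sup>2) (2 * r * s2) (pd2 X (r, s2))) has_vector_derivative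
      vec_lift (2 * s1) (2 * s2) (pd12 X (s1, s2))) (at s1 within {0..1})"
    by (intro has_vector_derivative_vec_lift)
      (auto intro!: derivative_eq_intros simp flip: has_real_derivative_iff_has_vector_derivative)
  \<comment> \<open>The formula \<open>pd2\<close> is known on the square only; this suffices
    because the derivative is taken within \<open>{0..1}\<close>.\<close>
  hence "((\<lambda>r. pd2 (lift2D X) (r, s2)) has_vector_derivative
      vec_lift (2 * s1) (2 * s2) (pd12 X (s1, s2))) (at s1 within {0..1})"
    by (rule has_vector_derivative_transform[OF s(1), rotated]) (use s in \<open>simp add: pd2\<close>)
  thus ?thesis
    using s by (simp add: pd12_def pd1_def vector_derivative_within_closed_interval)
qed

section \<open>Signature entries of the lift and their moments\<close>

text \<open>Since \<open>\<nu>\<close> maps positions to positions, the mixed points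
  \<open>(fst (r i), snd (r (\<nu> i)))\<close> stay in the square. This yields the forward
  implication of the theorem.\<close>

lemma signature2D_cong:
  assumes "\<And>p. p \<in> unit_square \<Longrightarrow> pd12 Z p = pd12 W p" and "t \<in> unit_square" and "x \<in> extended_words"
  shows "signature2D Z (0, 0) t x = signature2D W (0, 0) t x"
proof -
  obtain w \<nu> where x: "x = (w, \<nu>)" by (cases x)
  have \<nu>: "\<nu> permutes {..<length w}" using assms(3) by (simp add: x extended_words_def)
  show ?thesis
    unfolding x signature2D_def prod.case
  proof (rule set_lebesgue_integral_cong[OF simplex2_measurable], intro allI impI prod.cong refl)
    fix r i
    assume r: "r \<in> simplex2 (length w) (0, 0) t" and i: "i \<in> {..<length w}"
    have "\<nu> i < length w" using permutes_in_image[OF \<nu>, of i] i by simp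
    hence "(fst (r i), snd (r (\<nu> i))) \<in> unit_square"
      using i simplex2_component[OF r assms(2)] by (simp add: unit_square_def mem_Times_iff)
    thus "pd12 Z (fst (r i), snd (r (\<nu> i))) $ (w ! i) = pd12 W (fst (r i), snd (r (\<nu> i))) $ (w ! i)"
      by (simp only: assms(1))
  qed
qed

lemma signature2D_id:
  "signature2D Z (0, 0) t (w, id) = ordered_integral (map (\<lambda>k p. pd12 Z p $ k) w) t"
proof -
  have "(\<Prod>i<length w. pd12 Z (fst (r i), snd (r (id i))) $ (w ! i)) =
      (\<Prod>i<length w. (map (\<lambda>k p. pd12 Z p $ k) w ! i) (r i))" for r
    by (rule prod.cong) simp_all
  thus ?thesis
    by (simp only: signature2D_def ordered_integral_def prod.case length_map)
qed

lemma continuous_on_pd12_component: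
  assumes "C2_square X"
  shows "continuous_on unit_square (\<lambda>p. pd12 X p $ i)"
proof -
  have "continuous_on unit_square (pd12 X)"
    using assms by (simp only: C2_square_def C1_square_def [of "pd2 X"] pd12_def)
  thus ?thesis by (rule continuous_on_component)
qed

text \<open>With the letter \<open>Inr i\<close> last, the extra letters before it integrate to a
  monomial in the last point. They alone produce \<open>c\<close>, so one constant serves all fields
  \<open>X\<close> and cancels when two of them are compared.\<close>

lemma signature2D_lift2D_moment:
  obtains c where "c > 0" and
    "\<And>X :: real \<times> real \<Rightarrow> real ^ 'd. C2_square X \<Longrightarrow>
      signature2D (lift2D X) (0, 0) (1, 1) (replicate a (Inl 0) @ replicate b (Inl 1) @ [Inr i], id) =
      c * integral unit_square (\<lambda>p. pd12 X p $ i * (fst p ^ (2 * a + b) * snd p ^ (a + 2 * b)))"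
proof -
  let ?gs = "replicate a (\<lambda>p :: real \<times> real. 2 * fst p) @ replicate b (\<lambda>p. 2 * snd p)"
  let ?w = "replicate a (Inl 0) @ replicate b (Inl 1) @ [Inr i] :: (2 + 'd) list"
  obtain c where c: "c > 0"
    and mono: "\<And>t. t \<in> unit_square \<Longrightarrow> ordered_integral ?gs t = c * (fst t ^ (2 * a + b) * snd t ^ (a + 2 * b))"
    using ordered_integral_monomial[of a b] by blast
  show thesis
  proof (rule that[OF c])
    fix X :: "real \<times> real \<Rightarrow> real ^ 'd"
    assume X: "C2_square X"
    have one: "(1, 1) \<in> unit_square" by (simp add: unit_square_def)
    have cont: "continuous_on unit_square (ordered_integral ?gs)"
      by (subst continuous_on_cong[OF refl mono]) (auto intro!: continuous_intros)
    have lift: "pd12 (lift2D X) p = vec_lift (2 * fst p) (2 * snd p) (pd12 X p)" if "p \<in> unit_square" for p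
      using pd12_lift2D[OF X, of "fst p" "snd p"] that by simp
    have "signature2D (lift2D X) (0, 0) (1, 1) (?w, id) = ordered_integral (?gs @ [\<lambda>p. pd12 X p $ i]) (1, 1)"
      unfolding signature2D_id
      by (rule ordered_integral_cong[OF _ one]) (auto simp: nth_append lift vec_lift_def nth_Cons')
    also have "\<dots> = integral unit_square (\<lambda>p. pd12 X p $ i * ordered_integral ?gs p)"
      unfolding unit_square_eq_cbox
      by (rule ordered_integral_snoc[OF _ continuous_on_pd12_component[OF X] cont one])
        (auto intro!: continuous_intros)
    also have "\<dots> = integral unit_square (\<lambda>p. c * (pd12 X p $ i * (fst p ^ (2 * a + b) * snd p ^ (a + 2 * b))))"
      by (intro integral_cong) (simp add: mono)
    finally show "signature2D (lift2D X) (0, 0) (1, 1) (?w, id) =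
        c * integral unit_square (\<lambda>p. pd12 X p $ i * (fst p ^ (2 * a + b) * snd p ^ (a + 2 * b)))"
      by simp
  qed
qed

theorem theorem6p4:
  fixes X Y :: "real \<times> real \<Rightarrow> real ^ 'd"
  assumes "C2_square X" and "C2_square Y"
  shows "pd12_equiv X Y \<longleftrightarrow>
    (\<forall>x \<in> extended_words.
       signature2D (lift2D X) (0, 0) (1, 1) x = signature2D (lift2D Y) (0, 0) (1, 1) x)"
proof
  assume eq: "pd12_equiv X Y"
  have "pd12 (lift2D X) p = pd12 (lift2D Y) p" if "p \<in> unit_square" for p
    using pd12_lift2D[OF assms(1), of "fst p" "snd p"] pd12_lift2D[OF assms(2), of "fst p" "snd p"] eq that
    by (simp add: pd12_equiv_def)
  thus "\<forall>x \<in> extended_words.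
       signature2D (lift2D X) (0, 0) (1, 1) x = signature2D (lift2D Y) (0, 0) (1, 1) x"
    by (intro ballI signature2D_cong) (auto simp: unit_square_def)
next
  assume sig: "\<forall>x \<in> extended_words.
       signature2D (lift2D X) (0, 0) (1, 1) x = signature2D (lift2D Y) (0, 0) (1, 1) x"
  \<comment> \<open>Componentwise, the difference of the mixed derivatives has vanishing moments:
    \<open>sig\<close> is applied to the words \<open>?w\<close>, one for each pair of exponents
    \<open>a\<close>, \<open>b\<close>.\<close>
  have "pd12 X p $ i - pd12 Y p $ i = 0" if p: "p \<in> unit_square" for p i
  proof (rule vanishing_moments_imp_zero[OF _ _ p])
    note contX = continuous_on_pd12_component[OF assms(1), of i]
      and contY = continuous_on_pd12_component[OF assms(2), of i]
    show "continuous_on unit_square (\<lambda>p. pd12 X p $ i - pd12 Y p $ i)"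
      by (intro continuous_intros contX contY)
    fix a b
    let ?m = "\<lambda>p :: real \<times> real. fst p ^ (2 * a + b) * snd p ^ (a + 2 * b)"
    let ?w = "replicate a (Inl 0) @ replicate b (Inl 1) @ [Inr i] :: (2 + 'd) list"
    obtain c where c: "c > 0" and moment: "\<And>X :: real \<times> real \<Rightarrow> real ^ 'd. C2_square X \<Longrightarrow>
        signature2D (lift2D X) (0, 0) (1, 1) (?w, id) = c * integral unit_square (\<lambda>p. pd12 X p $ i * ?m p)"
      using signature2D_lift2D_moment[of a b i] by blast
    have "(?w, id) \<in> extended_words" by (simp add: extended_words_def permutes_id)
    hence "integral unit_square (\<lambda>p. pd12 X p $ i * ?m p) = integral unit_square (\<lambda>p. pd12 Y p $ i * ?m p)"
      using sig c moment[OF assms(1)] moment[OF assms(2)] by auto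
    moreover have "(\<lambda>p. pd12 X p $ i * ?m p) integrable_on unit_square"
        "(\<lambda>p. pd12 Y p $ i * ?m p) integrable_on unit_square"
      using contX contY unfolding unit_square_eq_cbox by (auto intro!: integrable_continuous continuous_intros)
    ultimately show "integral unit_square (\<lambda>p. (pd12 X p $ i - pd12 Y p $ i) * ?m p) = 0"
      by (simp add: left_diff_distrib Henstock_Kurzweil_Integration.integral_diff)
  qed
  thus "pd12_equiv X Y"
    by (simp add: pd12_equiv_def vec_eq_iff)
qed

end
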